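(* Let $c$ be an integer with $c>1$ and let $a,b>0$ be real. Put $y_n(x)=\mathcal{P}_n(x;a,b,c)$, $n\in\mathbb{Z}_+$, and $\xi=c-1$, and let $$d_k(x)=\left(\frac{(c-1)!}{k!}\right)^2\frac{1}{(c-1-k)!}\,x^k,\qquad k=0,1,\ldots,c-1,$$ $$M(x)=\begin{pmatrix} d_0(x)\\ d_1(x)\\ \vdots\\ d_\xi(x)\end{pmatrix}\bigl(d_0(x),d_1(x),\ldots,d_\xi(x)\bigr),\qquad x\in(0,1).$$ Then for all $n,m\in\mathbb{Z}_+$, $$\int_0^1 \bigl(y_n(x),y_n'(x),\ldots,y_n^{(\xi)}(x)\bigr)\,M(x)\begin{pmatrix} y_m(x)\\ y_m'(x)\\ \vdots\\ y_m^{(\xi)}(x)\end{pmatrix}(2x)^{a-1}(2-2x)^{b-1}\,dx=A_n\delta_{n,m},$$ where $$A_n=\frac{((c-1)!)^2\,2^{a+b-2}\,\Gamma(a+n)\Gamma(b+n)}{\binom{n+a-1}{n}^2(2n+a+b-1)\,n!\,\Gamma(n+a+b-1)},\qquad n\geq 1,$$ $$A_0=((c-1)!)^2\,2^{a+b-2}\,\mathrm{B}(a,b).$$ Moreover, let $D_\xi$ and $L_2$ be the differential operators $D_\xi y(t)=\sum_{k=0}^{\xi}d_k(t)y^{(k)}(t)$ and $L_2 y(t)=t(1-t)\,y''(t)+(a-t(a+b))\,y'(t)$. Then $$L_2 D_\xi y_n(t)=-n(n+a+b-1)\,D_\xi y_n(t),\qquad n\in\mathbb{Z}_+.$$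
   Context: $\mathbb{Z}_+$ is the set of non-negative integers, and $\delta_{n,m}$ is the Kronecker delta. The shifted factorial is $(u)_0=1$, $(u)_k=u(u+1)\cdots(u+k-1)$ for $k\geq 1$. For $a,b,c>0$ and $n\in\mathbb{Z}_+$, $$\mathcal{P}_n(x;a,b,c)={}_3F_2(-n,n-1+a+b,1;a,c;x)=\sum_{k=0}^{n}\frac{(-n)_k(n-1+a+b)_k(1)_k}{(a)_k(c)_k}\frac{x^k}{k!}.$$ For real $s>0$, $\binom{n+s-1}{n}=\frac{(s)_n}{n!}=\frac{\Gamma(n+s)}{n!\,\Gamma(s)}$. $\mathrm{B}(a,b)=\Gamma(a)\Gamma(b)/\Gamma(a+b)$ is the beta function. $L_2D_\xi$ denotes the composition of operators ($D_\xi$ is applied first). *)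

theory Defs
  imports "HOL-Analysis.Analysis" "Jordan_Normal_Form.Matrix"
begin

(* The parameter 1 in numerator position is kept, so that the coefficients are literally
   those of 3F2(-n, n-1+a+b, 1; a, c; x). *)
definition hyp_poly :: "real \<Rightarrow> real \<Rightarrow> real \<Rightarrow> nat \<Rightarrow> real \<Rightarrow> real" where
  "hyp_poly a b c n x =
     (\<Sum>k\<le>n. pochhammer (- real n) k * pochhammer (real n - 1 + a + b) k * pochhammer 1 k
              / (pochhammer a k * pochhammer c k) * (x ^ k / fact k))"

definition d_coeff :: "nat \<Rightarrow> nat \<Rightarrow> real \<Rightarrow> real" where
  "d_coeff c k x = (fact (c - 1) / fact k)\<^sup>2 * (1 / fact (c - 1 - k)) * x ^ k"

definition d_vec :: "nat \<Rightarrow> real \<Rightarrow> real vec" where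
  "d_vec c x = vec c (\<lambda>k. d_coeff c k x)"

(* column vector times row vector, a c x c matrix *)
definition M_mat :: "nat \<Rightarrow> real \<Rightarrow> real mat" where
  "M_mat c x = mat_of_cols c [d_vec c x] * mat_of_rows c [d_vec c x]"

(* Size c, since the derivatives of orders 0, ..., xi = c - 1 are collected. *)
definition jet :: "nat \<Rightarrow> (real \<Rightarrow> real) \<Rightarrow> real \<Rightarrow> real vec" where
  "jet c y x = vec c (\<lambda>k. (deriv ^^ k) y x)"

(* The range has c terms: the order xi of the operator is c - 1. *)
definition D_op :: "nat \<Rightarrow> (real \<Rightarrow> real) \<Rightarrow> real \<Rightarrow> real" where
  "D_op c y t = (\<Sum>k\<le>c - 1. d_coeff c k t * (deriv ^^ k) y t)"

definition L2_op :: "real \<Rightarrow> real \<Rightarrow> (real \<Rightarrow> real) \<Rightarrow> real \<Rightarrow> real" where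
  "L2_op a b y t = t * (1 - t) * (deriv ^^ 2) y t + (a - t * (a + b)) * deriv y t"

(* n = 0 is separate because (a + b - 1) * Gamma (a + b - 1) degenerates when a + b = 1. *)
definition A_norm :: "real \<Rightarrow> real \<Rightarrow> nat \<Rightarrow> nat \<Rightarrow> real" where
  "A_norm a b c n =
     (if n = 0 then (fact (c - 1))\<^sup>2 * 2 powr (a + b - 2) * Beta a b
      else (fact (c - 1))\<^sup>2 * 2 powr (a + b - 2) * Gamma (a + real n) * Gamma (b + real n)
           / (((real n + a - 1) gchoose n)\<^sup>2 * (2 * real n + a + b - 1) * fact n
              * Gamma (real n + a + b - 1)))"

definition integrand ::
    "real \<Rightarrow> real \<Rightarrow> nat \<Rightarrow> nat \<Rightarrow> nat \<Rightarrow> real \<Rightarrow> real" where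
  "integrand a b c n m x =
     scalar_prod (jet c (hyp_poly a b (real c) n) x)
                 (M_mat c x *\<^sub>v jet c (hyp_poly a b (real c) m) x)
     * (2 * x) powr (a - 1) * (2 - 2 * x) powr (b - 1)"

end

theory Submission
  imports Defs
begin

text \<open>The matrix weight \<open>M\<close> has rank one: it is the column \<open>d\<close> of coefficients of \<open>D\<^sub>\<xi>\<close> times
  its transpose. Hence the bilinear form of two jets is just the product \<open>(D\<^sub>\<xi> y\<^sub>n) (D\<^sub>\<xi> y\<^sub>m)\<close>
  (\<open>scalar_prod_M_mat_jet\<close>), and everything reduces to identifying \<open>D\<^sub>\<xi> y\<^sub>n\<close>.

  The operator \<open>D\<^sub>\<xi>\<close> is homogeneous of degree zero, so it is diagonal on monomials; Vandermonde's
  convolution shows that its eigenvalue on \<open>t ^ j\<close> is \<open>(c - 1)! (c)\<^sub>j / j!\<close> (\<open>D_op_power_sum\<close>). This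
  factor replaces \<open>(1)\<^sub>j / (c)\<^sub>j\<close> in the coefficients of the 3F2 polynomial by a constant, so that
  \<open>D\<^sub>\<xi> y\<^sub>n\<close> is \<open>(c - 1)!\<close> times the Jacobi polynomial \<open>2F1(-n, n-1+a+b; a; t)\<close> (\<open>D_op_hyp_poly\<close>).

  The eigenvalue equation for \<open>L\<^sub>2\<close> is then Gauss's hypergeometric equation, which compares
  coefficients through a two-term recursion (\<open>L2_op_jacobi_poly\<close>). For the integrals, the weight is a
  constant times \<open>t powr (a-1) * (1-t) powr (b-1)\<close>. Testing the Jacobi polynomial against powers of
  \<open>1 - t\<close>, rather than of \<open>t\<close>, gives a terminating 2F1 at \<open>1\<close>, which the Chu-Vandermonde formula sums
  to a multiple of \<open>(j+1-n)\<^sub>n\<close> (\<open>has_bochner_integral_jacobi_poly_moment\<close>). This vanishes for \<open>j < n\<close>,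
  which is orthogonality, and for \<open>j = n\<close> it yields the norm through the leading coefficient.\<close>

section \<open>Power sums and their derivatives\<close>

lemma higher_deriv_power_sum:
  fixes f :: "nat \<Rightarrow> real"
  shows "(deriv ^^ k) (\<lambda>x. \<Sum>j\<le>n. f j * x ^ j) =
         (\<lambda>x. \<Sum>j\<le>n. f j * (fact k * real (j choose k)) * x ^ (j - k))"
proof (induction k)
  case 0
  show ?case by simp
next
  case (Suc k)
  have coeff: "fact k * real (j choose k) * real (j - k) = fact (Suc k) * real (j choose Suc k)" for j
  proof -
    have "(j choose k) * (j - k) = Suc k * (j choose Suc k)"
      using binomial_absorb_comp[of j k] binomial_absorption[of k j]
      by (simp add: mult.commute)
    then have "real (j choose k) * real (j - k) = real (Suc k) * real (j choose Suc k)"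
      by (metis of_nat_mult)
    then show ?thesis by (simp add: algebra_simps)
  qed
  have "((\<lambda>x. \<Sum>j\<le>n. f j * (fact k * real (j choose k)) * x ^ (j - k)) has_real_derivative
         (\<Sum>j\<le>n. f j * (fact (Suc k) * real (j choose Suc k)) * x ^ (j - Suc k))) (at x)" for x :: real
  proof -
    have "((\<lambda>x. \<Sum>j\<le>n. f j * (fact k * real (j choose k)) * x ^ (j - k)) has_real_derivative
           (\<Sum>j\<le>n. f j * (fact k * real (j choose k)) * (real (j - k) * x ^ (j - Suc k)))) (at x)"
      by (intro DERIV_sum DERIV_cmult DERIV_pow[THEN DERIV_cong]) simp
    then show ?thesis by (simp only: mult.assoc flip: coeff)
  qed
  then have "deriv (\<lambda>x. \<Sum>j\<le>n. f j * (fact k * real (j choose k)) * x ^ (j - k)) =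
         (\<lambda>x. \<Sum>j\<le>n. f j * (fact (Suc k) * real (j choose Suc k)) * x ^ (j - Suc k))"
    by (intro ext DERIV_imp_deriv)
  then show ?case by (simp only: funpow.simps o_apply Suc)
qed

text \<open>Vandermonde's convolution after reflecting one of the two binomial coefficients.\<close>

lemma sum_binomial_products:
  "(\<Sum>k\<le>r. (r choose k) * (j choose k)) = (r + j) choose j"
proof -
  have "(r + j) choose r = (\<Sum>k\<le>r. (r choose k) * (j choose (r - k)))"
    by (rule vandermonde[symmetric])
  also have "\<dots> = (\<Sum>k\<le>r. (r choose (r - k)) * (j choose k))"
    by (rule sum.reindex_bij_witness[where i = "\<lambda>k. r - k" and j = "\<lambda>k. r - k"]) auto
  also have "\<dots> = (\<Sum>k\<le>r. (r choose k) * (j choose k))"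
    by (intro sum.cong) (auto simp: binomial_symmetric[symmetric])
  finally show ?thesis
    using binomial_symmetric[of j "r + j"] by simp
qed

text \<open>The coefficient of order \<open>k\<close> is proportional to \<open>t ^ k\<close>, so no degree is lost by differentiating.
  On \<open>t ^ j\<close> the factorials combine to \<open>(c-1)! (c-1 choose k) (j choose k)\<close>; summing over \<open>k\<close> leaves
  \<open>(c-1)! (c-1+j choose j)\<close>, which the right-hand side writes with a shifted factorial so that it
  can cancel against the denominators \<open>(c)\<^sub>j\<close> of the hypergeometric coefficients.\<close>

lemma D_op_power_sum:
  fixes f :: "nat \<Rightarrow> real"
  assumes "c > 0"
  shows "D_op c (\<lambda>x. \<Sum>j\<le>n. f j * x ^ j) t =
         (\<Sum>j\<le>n. fact (c - 1) * (pochhammer (real c) j / fact j) * f j * t ^ j)"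
proof -
  have monomial: "(\<Sum>k\<le>c - 1. d_coeff c k t * (fact k * real (j choose k) * t ^ (j - k))) =
        fact (c - 1) * (pochhammer (real c) j / fact j) * t ^ j" for j
  proof -
    have "d_coeff c k t * (fact k * real (j choose k) * t ^ (j - k)) =
          fact (c - 1) * real ((c - 1 choose k) * (j choose k)) * t ^ j" if "k \<le> c - 1" for k
    proof (cases "k \<le> j")
      case True
      then have "t ^ k * t ^ (j - k) = t ^ j" by (simp flip: power_add)
      moreover have "real (c - 1 choose k) = fact (c - 1) / (fact k * fact (c - 1 - k))"
        using that by (rule binomial_fact)
      ultimately show ?thesis
        by (simp add: d_coeff_def power2_eq_square field_simps)
    qed simp
    then have "(\<Sum>k\<le>c - 1. d_coeff c k t * (fact k * real (j choose k) * t ^ (j - k))) =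
          (\<Sum>k\<le>c - 1. fact (c - 1) * real ((c - 1 choose k) * (j choose k)) * t ^ j)"
      by (intro sum.cong) auto
    also have "\<dots> = fact (c - 1) * real (\<Sum>k\<le>c - 1. (c - 1 choose k) * (j choose k)) * t ^ j"
      by (simp add: sum_distrib_left sum_distrib_right)
    also have "real (\<Sum>k\<le>c - 1. (c - 1 choose k) * (j choose k)) = pochhammer (real c) j / fact j"
      using assms unfolding sum_binomial_products
      by (simp add: binomial_gbinomial gbinomial_pochhammer' of_nat_diff)
    finally show ?thesis .
  qed
  have "D_op c (\<lambda>x. \<Sum>j\<le>n. f j * x ^ j) t =
        (\<Sum>j\<le>n. \<Sum>k\<le>c - 1. f j * (d_coeff c k t * (fact k * real (j choose k) * t ^ (j - k))))"
    unfolding D_op_def higher_deriv_power_sum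
    by (subst sum.swap) (simp add: sum_distrib_left mult_ac)
  also have "\<dots> = (\<Sum>j\<le>n. f j * (fact (c - 1) * (pochhammer (real c) j / fact j) * t ^ j))"
    by (simp only: sum_distrib_left[symmetric] monomial)
  finally show ?thesis by (simp add: mult_ac)
qed

section \<open>Jacobi polynomials on the unit interval\<close>

definition jacobi_coeff :: "real \<Rightarrow> real \<Rightarrow> nat \<Rightarrow> nat \<Rightarrow> real" where
  "jacobi_coeff a b n k =
     pochhammer (- real n) k * pochhammer (real n - 1 + a + b) k / (pochhammer a k * fact k)"

text \<open>This is \<open>2F1(-n, n-1+a+b; a; x)\<close>, up to a constant the Jacobi polynomial with parameters
  \<open>a - 1\<close> and \<open>b - 1\<close> in the variable \<open>1 - 2 * x\<close>.\<close>

definition jacobi_poly :: "real \<Rightarrow> real \<Rightarrow> nat \<Rightarrow> real \<Rightarrow> real" where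
  "jacobi_poly a b n x = (\<Sum>k\<le>n. jacobi_coeff a b n k * x ^ k)"

text \<open>The eigenvalues of \<open>D\<^sub>\<xi>\<close> cancel the pair of parameters \<open>1\<close> and \<open>c\<close> of the 3F2 series.\<close>

lemma D_op_hyp_poly:
  assumes "c > 0"
  shows "D_op c (hyp_poly a b (real c) n) t = fact (c - 1) * jacobi_poly a b n t"
proof -
  define f where "f = (\<lambda>k. pochhammer (- real n) k * pochhammer (real n - 1 + a + b) k * pochhammer 1 k
              / (pochhammer a k * pochhammer (real c) k) / fact k)"
  have f: "hyp_poly a b (real c) n = (\<lambda>x. \<Sum>k\<le>n. f k * x ^ k)"
    by (rule ext) (simp add: hyp_poly_def f_def)
  have "pochhammer (real c) j \<noteq> 0" for j
    using assms pochhammer_pos[of "real c" j] by simp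
  then have "fact (c - 1) * (pochhammer (real c) j / fact j) * f j = fact (c - 1) * jacobi_coeff a b n j" for j
    by (simp add: f_def jacobi_coeff_def field_simps flip: pochhammer_fact)
  then show ?thesis
    unfolding f D_op_power_sum[OF assms] jacobi_poly_def by (simp add: sum_distrib_left mult.assoc)
qed

lemma jacobi_coeff_Suc:
  assumes "a > 0"
  shows "(real k + 1) * (real k + a) * jacobi_coeff a b n (Suc k) =
         (real k - real n) * (real k + real n - 1 + a + b) * jacobi_coeff a b n k"
proof -
  have "pochhammer a k \<noteq> 0" "a + real k \<noteq> 0"
    using assms pochhammer_pos[of a k] by auto
  then show ?thesis
    by (simp add: jacobi_coeff_def pochhammer_Suc divide_simps) (simp add: algebra_simps)
qed

text \<open>On \<open>t ^ k\<close> the operator gives \<open>k (k-1+a) t ^ (k-1) - k (k-1+a+b) t ^ k\<close>. After an index shift in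
  the first part, the recursion for the coefficients turns it into a multiple of \<open>t ^ k\<close>, and
  \<open>(k-n) (k+n-1+a+b) - k (k-1+a+b) = - n (n+a+b-1)\<close> is free of \<open>k\<close>.\<close>

lemma L2_op_jacobi_poly:
  assumes "a > 0"
  shows "L2_op a b (\<lambda>t. s * jacobi_poly a b n t) t =
         - real n * (real n + a + b - 1) * (s * jacobi_poly a b n t)"
proof -
  define f where "f = (\<lambda>k. s * jacobi_coeff a b n k)"
  have F: "(\<lambda>t. s * jacobi_poly a b n t) = (\<lambda>t. \<Sum>k\<le>n. f k * t ^ k)"
    by (rule ext) (simp add: f_def jacobi_poly_def sum_distrib_left mult.assoc)
  have term_eq: "t * (1 - t) * (f k * (fact 2 * real (k choose 2)) * t ^ (k - 2)) +
        (a - t * (a + b)) * (f k * (fact 1 * real (k choose 1)) * t ^ (k - 1)) =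
        real k * (real k - 1 + a) * f k * t ^ (k - 1) - real k * (real k - 1 + a + b) * f k * t ^ k" for k
  proof -
    consider "k = 0" | "k = 1" | m where "k = Suc (Suc m)"
      by (metis One_nat_def not0_implies_Suc)
    then show ?thesis
    proof cases
      case 3
      have c2: "2 * real (k choose 2) = (real m + 2) * (real m + 1)"
        using arg_cong[OF binomial_absorption[of 1 "m + 2"], of real] 3
        by (simp add: numeral_2_eq_2 algebra_simps)
      show ?thesis
        using c2 unfolding 3 by (simp add: fact_2) (simp add: algebra_simps)
    qed (auto simp: algebra_simps numeral_2_eq_2)
  qed
  have shift: "(\<Sum>k\<le>n. real k * (real k - 1 + a) * f k * t ^ (k - 1)) =
        (\<Sum>k\<le>n. (real k - real n) * (real k + real n - 1 + a + b) * f k * t ^ k)"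
  proof -
    have "(\<Sum>k\<le>n. real k * (real k - 1 + a) * f k * t ^ (k - 1)) =
          (\<Sum>k<n. (real k + 1) * (real k + a) * f (Suc k) * t ^ k)"
      by (subst sum.atMost_shift) (simp add: add.commute)
    also have "\<dots> = (\<Sum>k<n. (real k - real n) * (real k + real n - 1 + a + b) * f k * t ^ k)"
      unfolding f_def using jacobi_coeff_Suc[OF assms, of _ b n]
      by (intro sum.cong) (simp_all add: mult_ac)
    \<comment> \<open>The term \<open>k = n\<close> may be added, since its factor \<open>k - n\<close> vanishes.\<close>
    finally show ?thesis by (simp add: lessThan_Suc_atMost[symmetric])
  qed
  have "L2_op a b (\<lambda>t. \<Sum>k\<le>n. f k * t ^ k) t =
        (\<Sum>k\<le>n. real k * (real k - 1 + a) * f k * t ^ (k - 1) - real k * (real k - 1 + a + b) * f k * t ^ k)"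
    unfolding L2_op_def
    using higher_deriv_power_sum[of 2 f n] higher_deriv_power_sum[of 1 f n]
    by (simp only: funpow.simps One_nat_def o_id sum_distrib_left sum.distrib[symmetric]
          term_eq[unfolded One_nat_def])
  also have "\<dots> = (\<Sum>k\<le>n. - real n * (real n + a + b - 1) * (f k * t ^ k))"
    unfolding sum_subtractf shift unfolding sum_subtractf[symmetric]
    by (intro sum.cong) (auto simp: algebra_simps)
  finally show ?thesis
    unfolding F by (simp only: sum_distrib_left[symmetric] fun_cong[OF F, of t])
qed

section \<open>Integrals against the beta weight\<close>

text \<open>The indicator is part of the weight, so that all integrals are over the whole line and
  integrability and value can be carried together.\<close>

definition beta_weight :: "real \<Rightarrow> real \<Rightarrow> real \<Rightarrow> real" where
  "beta_weight a b x = indicator {0<..<1} x * (x powr (a - 1) * (1 - x) powr (b - 1))"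

text \<open>For a nonnegative function the gauge integral agrees with the Lebesgue integral, which makes
  Euler's beta integral a statement about absolute integrability as well.\<close>

lemma has_bochner_integral_beta_weight:
  assumes "a > 0" "b > 0"
  shows "has_bochner_integral lborel (beta_weight a b) (Beta a b)"
proof -
  have "((\<lambda>x. x powr (a - 1) * (1 - x) powr (b - 1)) has_integral Beta a b) {0<..<1}"
    using has_integral_Beta_real[OF assms] by (simp add: has_integral_Icc_iff_Ioo)
  then have "((\<lambda>x. if x \<in> {0<..<1} then x powr (a - 1) * (1 - x) powr (b - 1) else 0) has_integral Beta a b) UNIV"
    by (simp only: has_integral_restrict_UNIV)
  also have "(\<lambda>x. if x \<in> {0<..<1} then x powr (a - 1) * (1 - x) powr (b - 1) else 0) = beta_weight a b"
    by (auto simp: beta_weight_def)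
  finally have int: "(beta_weight a b has_integral Beta a b) UNIV" .
  have meas: "beta_weight a b \<in> borel_measurable borel"
    unfolding beta_weight_def by measurable
  have nonneg: "0 \<le> beta_weight a b x" for x
    by (simp add: beta_weight_def)
  have "0 \<le> Beta a b"
    using assms by (simp add: Beta_def)
  then show ?thesis
    using nn_integral_has_integral_lborel[OF meas nonneg int] meas nonneg
    by (intro has_bochner_integral_nn_integral) auto
qed

text \<open>Integer powers of \<open>x\<close> and \<open>1 - x\<close> are absorbed by shifting the parameters of the weight.\<close>

lemma has_bochner_integral_beta_moment:
  assumes "a > 0" "b > 0"
  shows "has_bochner_integral lborel (\<lambda>x. x ^ i * (1 - x) ^ j * beta_weight a b x)
           (Beta (a + real i) (b + real j))"
proof -
  have "beta_weight (a + real i) (b + real j) = (\<lambda>x. x ^ i * (1 - x) ^ j * beta_weight a b x)"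
  proof
    fix x :: real
    show "beta_weight (a + real i) (b + real j) x = x ^ i * (1 - x) ^ j * beta_weight a b x"
    proof (cases "x \<in> {0<..<1}")
      case True
      then have "x powr (a + real i - 1) = x ^ i * x powr (a - 1)"
        and "(1 - x) powr (b + real j - 1) = (1 - x) ^ j * (1 - x) powr (b - 1)"
        by (simp_all add: powr_realpow[symmetric] powr_add[symmetric] algebra_simps)
      then show ?thesis by (simp add: beta_weight_def)
    qed (simp add: beta_weight_def)
  qed
  then show ?thesis
    using has_bochner_integral_beta_weight[of "a + real i" "b + real j"] assms by simp
qed

lemma Beta_add_nat_left:
  fixes a b :: real
  assumes "a > 0" "b > 0"
  shows "Beta (a + real k) b = Beta a b * pochhammer a k / pochhammer (a + b) k"
proof -
  have "a \<notin> \<int>\<^sub>\<le>\<^sub>0" "a + b \<notin> \<int>\<^sub>\<le>\<^sub>0"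
    using assms by (auto elim!: nonpos_Ints_cases)
  moreover have "Gamma a > 0" "Gamma (a + b) > 0" "Gamma (a + b + real k) > 0"
    using assms by (auto intro!: Gamma_real_pos add_pos_nonneg)
  ultimately show ?thesis
    by (simp add: Beta_def pochhammer_Gamma field_simps)
qed

text \<open>Integrating term by term, \<open>Beta (a+k) (b+j)\<close> contributes the factor \<open>(a)\<^sub>k / (a+b+j)\<^sub>k\<close>, whose
  numerator cancels the denominator \<open>(a)\<^sub>k\<close> of the polynomial. What remains is
  \<open>2F1(-n, n-1+a+b; a+b+j; 1)\<close>, and the Chu-Vandermonde formula evaluates it.\<close>

lemma has_bochner_integral_jacobi_poly_moment:
  assumes "a > 0" "b > 0"
  shows "has_bochner_integral lborel (\<lambda>x. jacobi_poly a b n x * (1 - x) ^ j * beta_weight a b x)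
           (Beta a (b + real j) * pochhammer (real j + 1 - real n) n / pochhammer (a + b + real j) n)"
proof -
  have "has_bochner_integral lborel
          (\<lambda>x. \<Sum>k\<le>n. jacobi_coeff a b n k * (x ^ k * (1 - x) ^ j * beta_weight a b x))
          (\<Sum>k\<le>n. jacobi_coeff a b n k * Beta (a + real k) (b + real j))"
    using assms by (intro has_bochner_integral_sum has_bochner_integral_mult_right
        has_bochner_integral_beta_moment)
  moreover have "(\<lambda>x. \<Sum>k\<le>n. jacobi_coeff a b n k * (x ^ k * (1 - x) ^ j * beta_weight a b x)) =
        (\<lambda>x. jacobi_poly a b n x * (1 - x) ^ j * beta_weight a b x)"
    by (simp add: jacobi_poly_def sum_distrib_right mult.assoc)
  moreover have "(\<Sum>k\<le>n. jacobi_coeff a b n k * Beta (a + real k) (b + real j)) =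
        Beta a (b + real j) * pochhammer (real j + 1 - real n) n / pochhammer (a + b + real j) n"
  proof -
    have "jacobi_coeff a b n k * Beta (a + real k) (b + real j) =
          Beta a (b + real j) * (pochhammer (real n - 1 + a + b) k * pochhammer (- real n) k /
            (real (fact k) * pochhammer (a + b + real j) k))" for k
    proof -
      have "pochhammer a k > 0"
        using assms by (intro pochhammer_pos)
      moreover have "Beta (a + real k) (b + real j) =
            Beta a (b + real j) * pochhammer a k / pochhammer (a + b + real j) k"
        using Beta_add_nat_left[of a "b + real j" k] assms by (simp add: add.assoc)
      ultimately show ?thesis
        by (simp add: jacobi_coeff_def)
    qed
    then have "(\<Sum>k\<le>n. jacobi_coeff a b n k * Beta (a + real k) (b + real j)) =
          Beta a (b + real j) * (\<Sum>k = 0..n. pochhammer (real n - 1 + a + b) k * pochhammer (- real n) k /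
            (real (fact k) * pochhammer (a + b + real j) k))"
      by (simp add: sum_distrib_left atMost_atLeast0)
    also have "(\<Sum>k = 0..n. pochhammer (real n - 1 + a + b) k * pochhammer (- real n) k /
            (real (fact k) * pochhammer (a + b + real j) k)) =
          pochhammer (a + b + real j - (real n - 1 + a + b)) n / pochhammer (a + b + real j) n"
    proof (rule Vandermonde_pochhammer)
      show "\<forall>i\<in>{0..<n}. a + b + real j \<noteq> - real i"
        using assms by (auto simp: eq_neg_iff_add_eq_0)
    qed
    also have "a + b + real j - (real n - 1 + a + b) = real j + 1 - real n"
      by simp
    finally show ?thesis by simp
  qed
  ultimately show ?thesis by simp
qed

text \<open>The \<open>n\<close> consecutive factors start at the nonpositive integer \<open>j+1-n\<close> and end at \<open>j \<ge> 0\<close>, so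
  one of them is zero.\<close>

lemma jacobi_moment_vanishes:
  assumes "j < n"
  shows "pochhammer (real j + 1 - real n) n = 0"
proof -
  have "real j + 1 - real n = - real (n - 1 - j)" using assms by linarith
  moreover have "n - 1 - j < n" using assms by linarith
  ultimately show ?thesis by (simp only: pochhammer_of_nat_eq_0_iff)
qed

text \<open>A polynomial in \<open>x\<close> is expanded in powers of \<open>1 - x\<close>, against which the moments are known. All
  sums run to the same bound \<open>m\<close> because \<open>i choose j\<close> vanishes for \<open>j > i\<close>.\<close>

lemma power_sum_recentre:
  fixes f :: "nat \<Rightarrow> real"
  shows "(\<Sum>i\<le>m. f i * x ^ i) =
         (\<Sum>j\<le>m. (- 1) ^ j * (\<Sum>i\<le>m. f i * real (i choose j)) * (1 - x) ^ j)"
proof -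
  have "x ^ i = (\<Sum>j\<le>m. (- 1) ^ j * real (i choose j) * (1 - x) ^ j)" if "i \<le> m" for i
  proof -
    have "x ^ i = ((- (1 - x)) + 1) ^ i" by simp
    also have "\<dots> = (\<Sum>j\<le>i. real (i choose j) * (- (1 - x)) ^ j)"
      by (subst binomial_ring) simp
    also have "\<dots> = (\<Sum>j\<le>m. real (i choose j) * (- (1 - x)) ^ j)"
      using that by (intro sum.mono_neutral_left) auto
    also have "\<dots> = (\<Sum>j\<le>m. (- 1) ^ j * real (i choose j) * (1 - x) ^ j)"
      by (intro sum.cong refl) (subst power_minus, simp)
    finally show ?thesis .
  qed
  then have "(\<Sum>i\<le>m. f i * x ^ i) =
      (\<Sum>i\<le>m. \<Sum>j\<le>m. f i * ((- 1) ^ j * real (i choose j) * (1 - x) ^ j))"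
    by (simp add: sum_distrib_left)
  then show ?thesis
    by (subst (asm) sum.swap) (simp add: sum_distrib_left sum_distrib_right mult_ac)
qed

text \<open>The polynomial of the smaller index \<open>m\<close> is expanded in powers \<open>(1 - x) ^ j\<close> with \<open>j \<le> m\<close>. All
  moments with \<open>j < n\<close> vanish, so at most \<open>j = m = n\<close> contributes, and its coefficient in the
  expansion is the leading coefficient up to the sign \<open>(-1) ^ n\<close>.\<close>

lemma has_bochner_integral_jacobi_poly_product:
  assumes "a > 0" "b > 0" "m \<le> n"
  shows "has_bochner_integral lborel (\<lambda>x. jacobi_poly a b n x * jacobi_poly a b m x * beta_weight a b x)
           (if n = m then (- 1) ^ n * jacobi_coeff a b n n *
              (Beta a (b + real n) * fact n / pochhammer (a + b + real n) n) else 0)"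
proof -
  define g where "g = (\<lambda>j. (- 1) ^ j * (\<Sum>i\<le>m. jacobi_coeff a b m i * real (i choose j)))"
  define I where "I = (\<lambda>j. Beta a (b + real j) * pochhammer (real j + 1 - real n) n /
                          pochhammer (a + b + real j) n)"
  have "has_bochner_integral lborel
          (\<lambda>x. \<Sum>j\<le>m. g j * (jacobi_poly a b n x * (1 - x) ^ j * beta_weight a b x)) (\<Sum>j\<le>m. g j * I j)"
    unfolding I_def using assms
    by (intro has_bochner_integral_sum has_bochner_integral_mult_right
        has_bochner_integral_jacobi_poly_moment)
  moreover have "jacobi_poly a b m x = (\<Sum>j\<le>m. g j * (1 - x) ^ j)" for x
    unfolding jacobi_poly_def g_def by (rule power_sum_recentre)
  then have "(\<lambda>x. \<Sum>j\<le>m. g j * (jacobi_poly a b n x * (1 - x) ^ j * beta_weight a b x)) =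
        (\<lambda>x. jacobi_poly a b n x * jacobi_poly a b m x * beta_weight a b x)"
    by (simp add: sum_distrib_left sum_distrib_right mult_ac)
  moreover have "(\<Sum>j\<le>m. g j * I j) = (if n = m then (- 1) ^ n * jacobi_coeff a b n n *
              (Beta a (b + real n) * fact n / pochhammer (a + b + real n) n) else 0)"
  proof -
    have "I j = 0" if "j < n" for j
      using jacobi_moment_vanishes[OF that] by (simp add: I_def)
    then have "(\<Sum>j\<le>m. g j * I j) = (if n = m then g n * I n else 0)"
      using assms(3) by (auto simp: lessThan_Suc_atMost[symmetric])
    moreover have "g n = (- 1) ^ n * jacobi_coeff a b n n" if "n = m"
    proof -
      have "(\<Sum>i<n. jacobi_coeff a b n i * real (i choose n)) = 0"
        by (intro sum.neutral) auto
      then show ?thesis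
        using that by (simp add: g_def lessThan_Suc_atMost[symmetric])
    qed
    moreover have "I n = Beta a (b + real n) * fact n / pochhammer (a + b + real n) n"
      by (simp add: I_def pochhammer_fact)
    ultimately show ?thesis by (cases "n = m") simp_all
  qed
  ultimately show ?thesis by simp
qed

text \<open>Every shifted factorial is rewritten as a quotient of Gamma values, which then cancel. The base
  point \<open>s = n+a+b-1\<close> is positive only for \<open>n \<ge> 1\<close> in general, hence the separate case \<open>n = 0\<close>.\<close>

lemma jacobi_norm_eq_A_norm:
  assumes "a > 0" "b > 0"
  shows "(fact (c - 1))\<^sup>2 * 2 powr (a + b - 2) * ((- 1) ^ n * jacobi_coeff a b n n *
              (Beta a (b + real n) * fact n / pochhammer (a + b + real n) n)) = A_norm a b c n"
proof (cases "n = 0")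
  case True
  then show ?thesis by (simp add: A_norm_def jacobi_coeff_def)
next
  case False
  have nonpos: "x \<notin> \<int>\<^sub>\<le>\<^sub>0" if "x > 0" for x :: real
    using that by (auto elim!: nonpos_Ints_cases)
  define s where "s = real n + a + b - 1"
  have "s > 0" using assms False by (simp add: s_def)
  have lead: "(- 1) ^ n * jacobi_coeff a b n n = pochhammer s n / pochhammer a n"
  proof -
    have "pochhammer (- real n) n = (- 1) ^ n * fact n"
      by (simp add: pochhammer_same)
    moreover have "(- 1) ^ n * (- 1) ^ n = (1 :: real)"
      by (simp flip: power_mult_distrib)
    ultimately show ?thesis
      by (simp add: jacobi_coeff_def s_def algebra_simps)
  qed
  have ps: "pochhammer s n = Gamma (s + real n) / Gamma s"
    using \<open>s > 0\<close> by (intro pochhammer_Gamma nonpos)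
  have pa: "pochhammer a n = Gamma (a + real n) / Gamma a"
    using assms by (intro pochhammer_Gamma nonpos)
  \<comment> \<open>One step of the functional equation of Gamma splits off \<open>s + n = 2 * n + a + b - 1\<close>, the linear
    factor in the norm; the rest cancels against the leading coefficient.\<close>
  have pab: "pochhammer (a + b + real n) n = (s + real n) * Gamma (s + real n) / Gamma (a + b + real n)"
  proof -
    have "pochhammer (a + b + real n) n = Gamma (a + b + real n + real n) / Gamma (a + b + real n)"
      using assms by (intro pochhammer_Gamma nonpos) auto
    also have "a + b + real n + real n = (s + real n) + 1" by (simp add: s_def)
    also have "Gamma \<dots> = (s + real n) * Gamma (s + real n)"
      using \<open>s > 0\<close> by (intro Gamma_plus1 nonpos) auto
    finally show ?thesis .
  qed
  have gch: "(real n + a - 1) gchoose n = pochhammer a n / fact n"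
    by (simp add: gbinomial_pochhammer')
  have A: "A_norm a b c n = (fact (c - 1))\<^sup>2 * 2 powr (a + b - 2) * Gamma (a + real n) * Gamma (b + real n)
           / ((pochhammer a n / fact n)\<^sup>2 * (s + real n) * fact n * Gamma s)"
    using False by (simp add: A_norm_def s_def flip: gch)
  have pos: "Gamma s > 0" "Gamma (s + real n) > 0" "Gamma a > 0" "Gamma (a + real n) > 0"
    "Gamma (a + b + real n) > 0" "s + real n > 0"
    using assms \<open>s > 0\<close> by (auto intro!: Gamma_real_pos add_pos_nonneg)
  have B: "Beta a (b + real n) = Gamma a * Gamma (b + real n) / Gamma (a + b + real n)"
    by (simp add: Beta_def add.assoc)
  show ?thesis
    unfolding A lead pab ps B unfolding pa
    using pos[THEN less_imp_neq] by (simp add: power2_eq_square del: Gamma_eq_zero_iff) (simp add: mult_ac)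
qed

section \<open>The matrix weight\<close>

text \<open>The entries of the matrix are \<open>d\<^sub>i d\<^sub>j\<close>, so the double sum of the bilinear form factors.\<close>

lemma scalar_prod_M_mat_jet:
  assumes "c > 0"
  shows "scalar_prod (jet c y x) (M_mat c x *\<^sub>v jet c z x) = D_op c y x * D_op c z x"
proof -
  have D: "D_op c y x = (\<Sum>k = 0..<c. d_coeff c k x * (deriv ^^ k) y x)" for y
    unfolding D_op_def using assms
    by (intro sum.cong) auto
  have entry: "M_mat c x $$ (i, j) = d_coeff c i x * d_coeff c j x" if "i < c" "j < c" for i j
    using that by (simp add: M_mat_def d_vec_def scalar_prod_def mat_of_cols_def mat_of_rows_def)
  have dim: "dim_row (M_mat c x) = c" "dim_col (M_mat c x) = c"
    by (simp_all add: M_mat_def)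
  have "scalar_prod (jet c y x) (M_mat c x *\<^sub>v jet c z x) =
        (\<Sum>i = 0..<c. (deriv ^^ i) y x * (\<Sum>j = 0..<c. d_coeff c i x * d_coeff c j x * (deriv ^^ j) z x))"
    by (simp add: scalar_prod_def jet_def dim entry)
  also have "\<dots> = D_op c y x * D_op c z x"
    unfolding D sum_product by (simp add: sum_distrib_left mult_ac)
  finally show ?thesis .
qed

lemma indicator_integrand:
  assumes "c > 0"
  shows "indicator {0<..<1} x *\<^sub>R integrand a b c n m x =
         (fact (c - 1))\<^sup>2 * 2 powr (a + b - 2) *
           (jacobi_poly a b n x * jacobi_poly a b m x * beta_weight a b x)"
proof (cases "x \<in> {0<..<1}")
  case True
  have "(2 * x) powr (a - 1) = 2 powr (a - 1) * x powr (a - 1)"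
    and "(2 * (1 - x)) powr (b - 1) = 2 powr (b - 1) * (1 - x) powr (b - 1)"
    using True by (intro powr_mult; simp)+
  moreover have "2 - 2 * x = 2 * (1 - x)" by simp
  moreover have "2 powr (a + b - 2) = 2 powr (a - 1) * (2 powr (b - 1) :: real)"
    by (simp flip: powr_add)
  ultimately have "(2 * x) powr (a - 1) * (2 - 2 * x) powr (b - 1) =
        2 powr (a + b - 2) * (x powr (a - 1) * (1 - x) powr (b - 1))"
    by (simp only: mult_ac)
  then show ?thesis
    using True
    by (simp add: integrand_def scalar_prod_M_mat_jet[OF assms] D_op_hyp_poly[OF assms]
        beta_weight_def power2_eq_square mult_ac)
qed (simp add: beta_weight_def)

theorem theorem2:
  fixes a b :: real and c :: nat
  assumes "c > 1" and "a > 0" and "b > 0"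
  shows "(\<forall>n m. set_integrable lborel {0<..<1} (integrand a b c n m) \<and>
                (LBINT x:{0<..<1}. integrand a b c n m x) = (if n = m then A_norm a b c n else 0)) \<and>
         (\<forall>n t. L2_op a b (D_op c (hyp_poly a b (real c) n)) t =
                - real n * (real n + a + b - 1) * D_op c (hyp_poly a b (real c) n) t)"
proof (intro conjI allI)
  have "c > 0" using assms by simp
  fix n m
  have product: "has_bochner_integral lborel
        (\<lambda>x. jacobi_poly a b n x * jacobi_poly a b m x * beta_weight a b x)
        (if n = m then (- 1) ^ n * jacobi_coeff a b n n *
              (Beta a (b + real n) * fact n / pochhammer (a + b + real n) n) else 0)"
  \<comment> \<open>The product is symmetric in the two indices.\<close>
  proof (cases "m \<le> n")
    case True
    then show ?thesis
      using has_bochner_integral_jacobi_poly_product[OF assms(2,3)] by blast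
  next
    case False
    then show ?thesis
      using has_bochner_integral_jacobi_poly_product[OF assms(2,3), of n m] by (simp add: mult_ac)
  qed
  have "has_bochner_integral lborel (\<lambda>x. indicator {0<..<1} x *\<^sub>R integrand a b c n m x)
        (if n = m then A_norm a b c n else 0)"
    using has_bochner_integral_mult_right[OF product, of "(fact (c - 1))\<^sup>2 * 2 powr (a + b - 2)"]
    unfolding indicator_integrand[OF \<open>c > 0\<close>] jacobi_norm_eq_A_norm[OF assms(2,3), symmetric]
    by (simp split: if_splits)
  then show "set_integrable lborel {0<..<1} (integrand a b c n m)"
    and "(LBINT x:{0<..<1}. integrand a b c n m x) = (if n = m then A_norm a b c n else 0)"
    unfolding set_integrable_def set_lebesgue_integral_def by (auto simp: has_bochner_integral_iff)
next
  fix n t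
  have "D_op c (hyp_poly a b (real c) n) = (\<lambda>t. fact (c - 1) * jacobi_poly a b n t)"
    using assms by (intro ext D_op_hyp_poly) simp
  then show "L2_op a b (D_op c (hyp_poly a b (real c) n)) t =
        - real n * (real n + a + b - 1) * D_op c (hyp_poly a b (real c) n) t"
    using L2_op_jacobi_poly[OF assms(2)] by simp
qed

end
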